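(* Let $C$ be a nonempty closed convex subset of a real Hilbert space $H$. Let $T:C\to C$ be a $\kappa$-strict pseudo-contraction for some $0\le\kappa<1$ such that $F(T)\ne\emptyset$. Suppose $\{\alpha_n\}_{n\ge0}$ is a real sequence in $[0,1]$ with $\lim_{n\to\infty}\alpha_n=1$. Let $x_0\in C$ be arbitrary and let $\{x_n\}$ be generated, for $n\ge0$, by $$y_n=(1-\alpha_n)x_0+\alpha_nTx_n,$$ $$C_n=\{z\in C:\|y_n-z\|^2\le\|x_n-z\|^2+2(1-\alpha_n)\langle x_n-x_0,z\rangle+\theta_n\},$$ $$Q_n=\{z\in C:\langle z-x_n,x_n-x_0\rangle\ge0\},$$ $$x_{n+1}=P_{C_n^*\cap Q_n}x_0,$$ where $C_n^*$ is a closed convex set with $F(T)\subset C_n^*\subset C_n$ and $$\theta_n=(1-\alpha_n)(\|x_0\|^2-\|x_n\|^2)+\alpha_n\kappa\|x_n-Tx_n\|^2-\alpha_n(1-\alpha_n)\|x_0-Tx_n\|^2.$$ Then $\{x_n\}$ converges strongly to $P_{F(T)}x_0$.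
   Context: $F(T)=\{x\in C:Tx=x\}$. $T$ is a $\kappa$-strict pseudo-contraction if $\|Tx-Ty\|^2\le\|x-y\|^2+\kappa\|(I-T)x-(I-T)y\|^2$ for all $x,y\in C$ ($I$ the identity). For a nonempty closed convex set $D\subset H$, $P_D$ is the metric projection (nearest-point map) onto $D$. *)

theory Defs
  imports "HOL-Analysis.Analysis"
begin

definition fixed_points :: "'a set \<Rightarrow> ('a \<Rightarrow> 'a) \<Rightarrow> 'a set"
  where "fixed_points C T = {x \<in> C. T x = x}"

definition strict_pseudo_contraction_on ::
    "real \<Rightarrow> 'a::real_inner set \<Rightarrow> ('a \<Rightarrow> 'a) \<Rightarrow> bool"
  where "strict_pseudo_contraction_on \<kappa> C T \<longleftrightarrow>
    (\<forall>x\<in>C. \<forall>y\<in>C.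
       (norm (T x - T y))\<^sup>2 \<le> (norm (x - y))\<^sup>2 + \<kappa> * (norm ((x - T x) - (y - T y)))\<^sup>2)"

(* The library constant closest_point requires the class heine_borel, hence is not available
   in infinite-dimensional Hilbert spaces.  The description is meaningful when D is nonempty,
   closed and convex and the space is complete. *)
definition metric_proj :: "'a::real_inner set \<Rightarrow> 'a \<Rightarrow> 'a"
  where "metric_proj D a = (THE p. p \<in> D \<and> (\<forall>z\<in>D. norm (a - p) \<le> norm (a - z)))"

end

theory Submission
  imports Defs
begin

text \<open>
  Why the iterates converge. Write \<open>a = x 0\<close>, \<open>A v = v - T v\<close>, \<open>F = fixed_points C T\<close> and
  \<open>p = P\<^sub>F a\<close>. Three facts about the scheme carry the argument.

  \<^item> Each \<open>x n\<close> is the projection of \<open>a\<close> onto \<open>Q n\<close>, and \<open>F \<subseteq> Q n\<close> by induction. Hence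
    \<open>\<parallel>x n - a\<parallel> \<le> \<parallel>p - a\<parallel>\<close>, and as \<open>x (Suc n) \<in> Q n\<close>, the obtuse angle at \<open>x n\<close> gives
    \<open>\<parallel>x (Suc n) - x n\<parallel>\<^sup>2 \<le> \<parallel>x (Suc n) - a\<parallel>\<^sup>2 - \<parallel>x n - a\<parallel>\<^sup>2\<close>. The distances to \<open>a\<close> increase
    and are bounded, so consecutive iterates approach each other.

  \<^item> The inequality that defines \<open>Cn n\<close> is, after expanding the squares, nothing but
    \<open>\<alpha> n * \<parallel>T (x n) - z\<parallel>\<^sup>2 \<le> \<alpha> n * (\<parallel>x n - z\<parallel>\<^sup>2 + \<kappa> * \<parallel>A (x n)\<parallel>\<^sup>2)\<close>
    (lemma \<open>cq_halfspace_simplified\<close>). At \<open>z = x (Suc n)\<close> it bounds \<open>\<parallel>A (x n)\<parallel>\<close> by a multiple of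
    \<open>\<parallel>x n - x (Suc n)\<parallel>\<close> once \<open>\<alpha> n > 0\<close>, so \<open>A (x n) \<longlonglongrightarrow> 0\<close>.

  \<^item> A sequence in \<open>C\<close> with \<open>A (x n) \<longlonglongrightarrow> 0\<close> and \<open>\<parallel>x n - a\<parallel> \<le> \<parallel>p - a\<parallel>\<close> converges to \<open>p\<close>.

  The last fact is usually obtained from weak compactness of balls and demiclosedness of \<open>A\<close>. Here
  both are replaced by monotonicity of \<open>A\<close> (lemma \<open>strict_pseudo_contraction_monotone\<close>). By Minty's
  device, \<open>F\<close> is the set of \<open>q\<close> that satisfy the linear inequalities \<open>A v \<bullet> (q - v) \<le> 0\<close> for all
  \<open>v \<in> C\<close>. Relaxing the right-hand sides to \<open>\<epsilon> * (1 + \<parallel>v\<parallel>)\<close> gives closed convex sets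
  \<open>minty_set C T \<epsilon>\<close> which shrink to \<open>F\<close> and eventually contain the sequence. In a
  Hilbert space the distances from \<open>a\<close> to a shrinking sequence of nonempty closed convex sets,
  if they stay bounded, tend to the distance to the intersection (lemma
  \<open>nested_convex_infdist\<close>). So for large \<open>n\<close> \<open>x n\<close> and \<open>p\<close> both lie in a convex set, and both are nearly as
  close to \<open>a\<close> as any point of that set can be; by the parallelogram law they are close to each
  other.
\<close>

section \<open>Nearly nearest points of convex sets\<close>

text \<open>
  The parallelogram law for \<open>a - u\<close> and \<open>a - v\<close>, whose half-sum \<open>a - (u + v) / 2\<close> is at least
  as long as the distance to \<open>S\<close>. If \<open>u\<close> and \<open>v\<close> are both nearly nearest to \<open>a\<close>, the right-hand
  side is nearly \<open>0\<close>.
\<close>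

lemma convex_dist_nearly_nearest:
  fixes a u v :: "'a::real_inner"
  assumes "convex S" and "u \<in> S" and "v \<in> S"
  shows "(dist u v)\<^sup>2 \<le> 2 * (dist a u)\<^sup>2 + 2 * (dist a v)\<^sup>2 - 4 * (infdist a S)\<^sup>2"
proof -
  define m where "m = (1/2) *\<^sub>R u + (1/2) *\<^sub>R v"
  have "m \<in> S"
    unfolding m_def using assms by (intro convexD) auto
  then have "infdist a S \<le> dist a m"
    by (rule infdist_le)
  then have "(infdist a S)\<^sup>2 \<le> (dist a m)\<^sup>2"
    by (intro power_mono infdist_nonneg)
  moreover have "(dist u v)\<^sup>2 = 2 * (dist a u)\<^sup>2 + 2 * (dist a v)\<^sup>2 - 4 * (dist a m)\<^sup>2"
    unfolding m_def dist_norm power2_norm_eq_inner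
    by (simp add: inner_diff_left inner_diff_right inner_add_left inner_add_right
        inner_commute algebra_simps)
  ultimately show ?thesis
    by linarith
qed

text \<open>
  A substitute for weak compactness. Points \<open>u n \<in> K n\<close> that nearly realise the distance to \<open>a\<close>
  form a Cauchy sequence: for \<open>n \<ge> m\<close> both \<open>u m\<close> and \<open>u n\<close> lie in \<open>K m\<close>, and the increasing
  bounded distances converge.
\<close>

lemma nested_convex_infdist:
  fixes K :: "nat \<Rightarrow> 'a::{real_inner, complete_space} set"
  assumes closed: "\<And>n. closed (K n)" and convex: "\<And>n. convex (K n)"
    and nonempty: "\<And>n. K n \<noteq> {}" and nested: "\<And>m n. m \<le> n \<Longrightarrow> K n \<subseteq> K m"
    and bounded: "\<And>n. infdist a (K n) \<le> B"
  obtains q where "\<And>n. q \<in> K n" and "(\<lambda>n. infdist a (K n)) \<longlonglongrightarrow> dist a q"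
proof -
  have "incseq (\<lambda>n. infdist a (K n))"
    unfolding incseq_def by (intro allI impI infdist_mono nested nonempty)
  with bounded obtain d where d: "(\<lambda>n. infdist a (K n)) \<longlonglongrightarrow> d"
    by (meson incseq_convergent)
  have "\<exists>u\<in>K n. dist a u < infdist a (K n) + 1 / real (Suc n)" for n
  proof -
    have "\<exists>w\<in>dist a ` K n. w < infdist a (K n) + 1 / real (Suc n)"
      by (rule cInf_lessD) (simp_all add: nonempty infdist_notempty)
    then show ?thesis
      by auto
  qed
  then obtain u where u: "\<And>n. u n \<in> K n"
    and u_less: "\<And>n. dist a (u n) < infdist a (K n) + 1 / real (Suc n)"
    by metis
  have "(\<lambda>n. infdist a (K n) + 1 / real (Suc n)) \<longlonglongrightarrow> d"
    using tendsto_add[OF d LIMSEQ_Suc[OF lim_1_over_n]] by simp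
  then have dist_u: "(\<lambda>n. dist a (u n)) \<longlonglongrightarrow> d"
    by (rule tendsto_sandwich[rotated 2, OF d])
      (intro always_eventually allI infdist_le u less_imp_le[OF u_less])+
  have "Cauchy u"
  proof (rule CauchyI')
    fix e :: real
    assume "0 < e"
    then have e: "0 < e\<^sup>2 / 8"
      by simp
    have "\<forall>\<^sub>F n in sequentially. dist ((dist a (u n))\<^sup>2) (d\<^sup>2) < e\<^sup>2 / 8
        \<and> dist ((infdist a (K n))\<^sup>2) (d\<^sup>2) < e\<^sup>2 / 8"
      using e by (intro eventually_conj tendstoD tendsto_power dist_u d)
    then obtain N where N: "\<And>n. n \<ge> N \<Longrightarrow> \<bar>(dist a (u n))\<^sup>2 - d\<^sup>2\<bar> < e\<^sup>2 / 8"
      "\<And>n. n \<ge> N \<Longrightarrow> \<bar>(infdist a (K n))\<^sup>2 - d\<^sup>2\<bar> < e\<^sup>2 / 8"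
      unfolding eventually_sequentially dist_real_def by blast
    have "dist (u m) (u n) < e" if "m \<ge> N" "n > m" for m n
    proof -
      have "u n \<in> K m"
        using u[of n] nested[of m n] that by auto
      then have "(dist (u m) (u n))\<^sup>2
          \<le> 2 * (dist a (u m))\<^sup>2 + 2 * (dist a (u n))\<^sup>2 - 4 * (infdist a (K m))\<^sup>2"
        using u convex by (intro convex_dist_nearly_nearest)
      also have "\<dots> < e\<^sup>2"
        using N(1)[of m] N(1)[of n] N(2)[of m] that by (simp add: abs_if split: if_splits)
      finally show ?thesis
        using \<open>0 < e\<close> by (simp add: power_less_imp_less_base)
    qed
    then show "\<exists>M. \<forall>m\<ge>M. \<forall>n>m. dist (u m) (u n) < e"
      by blast
  qed
  then obtain q where q: "u \<longlonglongrightarrow> q"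
    using Cauchy_convergent_iff convergent_def by blast
  have "q \<in> K n" for n
  proof (rule Lim_in_closed_set[OF closed _ _ q])
    show "\<forall>\<^sub>F k in sequentially. u k \<in> K n"
      using u nested unfolding eventually_sequentially by blast
  qed simp
  moreover have "d = dist a q"
    using dist_u tendsto_dist[OF tendsto_const q] by (rule LIMSEQ_unique)
  ultimately show thesis
    using that d by blast
qed

lemma nearest_point_exists:
  fixes D :: "'a::{real_inner, complete_space} set"
  assumes "closed D" and "convex D" and "D \<noteq> {}"
  obtains q where "q \<in> D" and "\<And>z. z \<in> D \<Longrightarrow> dist a q \<le> dist a z"
proof -
  obtain q where q: "q \<in> D" "(\<lambda>n::nat. infdist a D) \<longlonglongrightarrow> dist a q"
    using nested_convex_infdist[of "\<lambda>_. D" a "infdist a D"] assms by auto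
  then have "dist a q = infdist a D"
    by (simp add: LIMSEQ_const_iff)
  with q(1) show thesis
    using that infdist_le by metis
qed

lemma metric_proj_nearest:
  fixes D :: "'a::{real_inner, complete_space} set"
  assumes "closed D" and "convex D" and "D \<noteq> {}"
  shows "metric_proj D a \<in> D" and "\<And>z. z \<in> D \<Longrightarrow> dist a (metric_proj D a) \<le> dist a z"
proof -
  obtain q where q: "q \<in> D" "\<And>z. z \<in> D \<Longrightarrow> dist a q \<le> dist a z"
    using nearest_point_exists[OF assms] by blast
  have "metric_proj D a = q"
    unfolding metric_proj_def
  proof (rule the_equality)
    show "q \<in> D \<and> (\<forall>z\<in>D. norm (a - q) \<le> norm (a - z))"
      using q by (simp add: dist_norm)
    show "r = q" if "r \<in> D \<and> (\<forall>z\<in>D. norm (a - r) \<le> norm (a - z))" for r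
      using any_closest_point_unique[OF assms(2,1), of r q a] that q by (simp add: dist_norm)
  qed
  with q show "metric_proj D a \<in> D" "\<And>z. z \<in> D \<Longrightarrow> dist a (metric_proj D a) \<le> dist a z"
    by simp_all
qed

lemma metric_proj_obtuse:
  fixes D :: "'a::{real_inner, complete_space} set"
  assumes "closed D" and "convex D" and "z \<in> D"
  shows "0 \<le> (z - metric_proj D a) \<bullet> (metric_proj D a - a)"
proof -
  have "D \<noteq> {}"
    using assms by blast
  note near = metric_proj_nearest[OF assms(1,2) this]
  have "(a - metric_proj D a) \<bullet> (z - metric_proj D a) \<le> 0"
    using any_closest_point_dot[OF assms(2,1) near(1) assms(3)] near(2) by simp
  then show ?thesis
    by (simp add: inner_diff_left inner_diff_right inner_commute)
qed

text \<open>
  Approximation from outside: the points \<open>x n\<close> need not lie in the limit set \<open>\<Inter>m. K m\<close>, but they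
  end up in every \<open>K m\<close> and are no further from \<open>a\<close> than the projection onto the limit set.
  Within \<open>K m\<close> that is nearly optimal for large \<open>m\<close>.
\<close>

lemma converges_to_nested_projection:
  fixes K :: "nat \<Rightarrow> 'a::{real_inner, complete_space} set"
  assumes closed: "\<And>n. closed (K n)" and convex: "\<And>n. convex (K n)"
    and nested: "\<And>m n. m \<le> n \<Longrightarrow> K n \<subseteq> K m" and p: "\<And>n. p \<in> K n"
    and p_nearest: "\<And>q. (\<And>n. q \<in> K n) \<Longrightarrow> dist a p \<le> dist a q"
    and x_near: "\<And>n. dist a (x n) \<le> dist a p"
    and x_in: "\<And>m. \<forall>\<^sub>F n in sequentially. x n \<in> K m"
  shows "x \<longlonglongrightarrow> p"
proof -
  have le: "infdist a (K n) \<le> dist a p" for n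
    using p by (rule infdist_le)
  have "K n \<noteq> {}" for n
    using p by blast
  then obtain q where q: "\<And>n. q \<in> K n" and lim: "(\<lambda>n. infdist a (K n)) \<longlonglongrightarrow> dist a q"
    using nested_convex_infdist[of K a "dist a p"] closed convex nested le by metis
  have "dist a q \<le> dist a p"
    using lim le by (intro LIMSEQ_le_const2) auto
  with p_nearest[OF q] have lim_p: "(\<lambda>n. infdist a (K n)) \<longlonglongrightarrow> dist a p"
    using lim by simp
  show ?thesis
  proof (rule tendstoI)
    fix e :: real
    assume "0 < e"
    then have "\<forall>\<^sub>F m in sequentially. dist ((infdist a (K m))\<^sup>2) ((dist a p)\<^sup>2) < e\<^sup>2 / 4"
      by (intro tendstoD tendsto_power lim_p) simp
    then obtain m where "dist ((infdist a (K m))\<^sup>2) ((dist a p)\<^sup>2) < e\<^sup>2 / 4"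
      by (auto simp: eventually_sequentially)
    then have m: "4 * (dist a p)\<^sup>2 - 4 * (infdist a (K m))\<^sup>2 < e\<^sup>2"
      by (simp add: dist_real_def abs_if split: if_splits)
    have "dist (x n) p < e" if "x n \<in> K m" for n
    proof -
      have "(dist (x n) p)\<^sup>2
          \<le> 2 * (dist a (x n))\<^sup>2 + 2 * (dist a p)\<^sup>2 - 4 * (infdist a (K m))\<^sup>2"
        using convex that p by (intro convex_dist_nearly_nearest)
      moreover have "(dist a (x n))\<^sup>2 \<le> (dist a p)\<^sup>2"
        using x_near by (intro power_mono) auto
      ultimately have "(dist (x n) p)\<^sup>2 < e\<^sup>2"
        using m by linarith
      with \<open>0 < e\<close> show ?thesis
        by (simp add: power_less_imp_less_base)
    qed
    with x_in[of m] show "\<forall>\<^sub>F n in sequentially. dist (x n) p < e"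
      by (auto elim: eventually_mono)
  qed
qed

section \<open>Minty's description of the fixed points\<close>

text \<open>
  Expand \<open>\<parallel>T u - T v\<parallel>\<^sup>2 = \<parallel>(u - v) - (A u - A v)\<parallel>\<^sup>2\<close> with \<open>A = I - T\<close>: the defining inequality
  says that \<open>A\<close> is inverse strongly monotone.
\<close>

lemma strict_pseudo_contraction_inverse_strongly_monotone:
  assumes "strict_pseudo_contraction_on \<kappa> C T" and "u \<in> C" and "v \<in> C"
  shows "(1 - \<kappa>) * (norm ((u - T u) - (v - T v)))\<^sup>2 \<le> 2 * (((u - T u) - (v - T v)) \<bullet> (u - v))"
proof -
  define w where "w = (u - T u) - (v - T v)"
  have "T u - T v = (u - v) - w"
    by (simp add: w_def)
  then have "(norm (T u - T v))\<^sup>2 = (norm (u - v))\<^sup>2 - 2 * (w \<bullet> (u - v)) + (norm w)\<^sup>2"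
    unfolding power2_norm_eq_inner
    by (simp add: inner_diff_left inner_diff_right inner_commute)
  moreover have "(norm (T u - T v))\<^sup>2 \<le> (norm (u - v))\<^sup>2 + \<kappa> * (norm w)\<^sup>2"
    using assms by (simp add: strict_pseudo_contraction_on_def w_def)
  ultimately show ?thesis
    unfolding w_def[symmetric] by (simp add: algebra_simps)
qed

lemma strict_pseudo_contraction_monotone:
  assumes "strict_pseudo_contraction_on \<kappa> C T" and "\<kappa> < 1" and "u \<in> C" and "v \<in> C"
  shows "(v - T v) \<bullet> (u - v) \<le> (u - T u) \<bullet> (u - v)"
proof -
  have "0 \<le> (1 - \<kappa>) * (norm ((u - T u) - (v - T v)))\<^sup>2"
    using assms(2) by simp
  with strict_pseudo_contraction_inverse_strongly_monotone[OF assms(1,3,4)] show ?thesis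
    by (simp add: inner_diff_left)
qed

lemma strict_pseudo_contraction_displacement_lipschitz:
  assumes "strict_pseudo_contraction_on \<kappa> C T" and "\<kappa> < 1" and "u \<in> C" and "v \<in> C"
  shows "(1 - \<kappa>) * norm ((u - T u) - (v - T v)) \<le> 2 * norm (u - v)"
proof -
  define w where "w = (u - T u) - (v - T v)"
  have "(1 - \<kappa>) * (norm w)\<^sup>2 \<le> 2 * (w \<bullet> (u - v))"
    using strict_pseudo_contraction_inverse_strongly_monotone[OF assms(1,3,4)]
    by (simp add: w_def)
  also have "\<dots> \<le> 2 * (norm w * norm (u - v))"
    by (simp add: norm_cauchy_schwarz)
  finally have "norm w * ((1 - \<kappa>) * norm w) \<le> norm w * (2 * norm (u - v))"
    by (simp add: power2_eq_square mult_ac)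
  then show ?thesis
    unfolding w_def[symmetric] by (cases "norm w = 0") (auto simp: mult_le_cancel_left)
qed

text \<open>
  The weight \<open>1 + \<parallel>v\<parallel>\<close> makes the slack uniform in \<open>v\<close>: monotonicity of \<open>A = I - T\<close>
  bounds \<open>A v \<bullet> (q - v)\<close> by \<open>A q \<bullet> (q - v)\<close>, which grows linearly in \<open>v\<close>.
\<close>

definition minty_set :: "'a::real_inner set \<Rightarrow> ('a \<Rightarrow> 'a) \<Rightarrow> real \<Rightarrow> 'a set"
  where "minty_set C T \<epsilon> = {q \<in> C. \<forall>v\<in>C. (v - T v) \<bullet> (q - v) \<le> \<epsilon> * (1 + norm v)}"

lemma minty_set_eq_INT:
  "minty_set C T \<epsilon> = C \<inter> (\<Inter>v\<in>C. {q. (v - T v) \<bullet> q \<le> \<epsilon> * (1 + norm v) + (v - T v) \<bullet> v})"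
  by (auto simp: minty_set_def inner_diff_right algebra_simps)

lemma closed_minty_set: "closed C \<Longrightarrow> closed (minty_set C T \<epsilon>)"
  unfolding minty_set_eq_INT by (intro closed_Int closed_INT ballI closed_halfspace_le)

lemma convex_minty_set: "convex C \<Longrightarrow> convex (minty_set C T \<epsilon>)"
  unfolding minty_set_eq_INT by (intro convex_Int convex_INT convex_halfspace_le)

lemma minty_set_mono: "\<epsilon> \<le> \<delta> \<Longrightarrow> minty_set C T \<epsilon> \<subseteq> minty_set C T \<delta>"
  unfolding minty_set_def
  by (auto intro!: order_trans[OF _ mult_right_mono[of \<epsilon> \<delta>]] add_nonneg_nonneg)

lemma approximate_fixed_point_in_minty_set:
  assumes "strict_pseudo_contraction_on \<kappa> C T" and "\<kappa> < 1" and "q \<in> C"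
    and "norm q \<le> B" and "norm (q - T q) * (1 + B) \<le> \<epsilon>"
  shows "q \<in> minty_set C T \<epsilon>"
proof -
  have "(v - T v) \<bullet> (q - v) \<le> \<epsilon> * (1 + norm v)" if "v \<in> C" for v
  proof -
    have "0 \<le> B"
      using assms(4) norm_ge_zero[of q] by linarith
    have "(v - T v) \<bullet> (q - v) \<le> (q - T q) \<bullet> (q - v)"
      using strict_pseudo_contraction_monotone assms(1-3) that by blast
    also have "\<dots> \<le> norm (q - T q) * norm (q - v)"
      by (rule norm_cauchy_schwarz)
    also have "\<dots> \<le> norm (q - T q) * ((1 + B) * (1 + norm v))"
    proof (rule mult_left_mono)
      have "0 \<le> B * norm v"
        using \<open>0 \<le> B\<close> by simp
      then show "norm (q - v) \<le> (1 + B) * (1 + norm v)"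
        using norm_triangle_ineq4[of q v] assms(4) by (simp add: algebra_simps)
    qed simp
    also have "\<dots> = norm (q - T q) * (1 + B) * (1 + norm v)"
      by simp
    also have "\<dots> \<le> \<epsilon> * (1 + norm v)"
      using assms(5) by (intro mult_right_mono) auto
    finally show ?thesis .
  qed
  with assms(3) show ?thesis
    by (simp add: minty_set_def)
qed

text \<open>
  Minty's device: test the inequality at points \<open>v = q + t (T q - q)\<close> of the segment from \<open>q\<close> to
  \<open>T q\<close>. After division by \<open>t\<close> it reads \<open>A v \<bullet> A q \<le> 0\<close>, and \<open>t \<rightarrow> 0\<close> gives \<open>\<parallel>A q\<parallel>\<^sup>2 \<le> 0\<close>.
\<close>

lemma minty_set_zero_fixed:
  assumes spc: "strict_pseudo_contraction_on \<kappa> C T" and "\<kappa> < 1" and "convex C"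
    and "T \<in> C \<rightarrow> C" and q: "q \<in> minty_set C T 0"
  shows "T q = q"
proof -
  define w where "w = q - T q"
  define v where "v n = q - (1 / real (Suc n)) *\<^sub>R w" for n
  have "q \<in> C" and "T q \<in> C"
    using q assms(4) by (auto simp: minty_set_def)
  have v_in: "v n \<in> C" for n
  proof -
    have "v n = (1 - 1 / real (Suc n)) *\<^sub>R q + (1 / real (Suc n)) *\<^sub>R T q"
      by (simp add: v_def w_def algebra_simps)
    with \<open>convex C\<close> \<open>q \<in> C\<close> \<open>T q \<in> C\<close> show ?thesis
      by (simp only:, intro convexD) (auto simp: field_simps)
  qed
  have "(v n - T (v n)) \<bullet> w \<le> 0" for n
  proof -
    have "(v n - T (v n)) \<bullet> (q - v n) \<le> 0"
      using q v_in by (auto simp: minty_set_def)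
    then have "(1 / real (Suc n)) * ((v n - T (v n)) \<bullet> w) \<le> 0"
      by (simp add: v_def)
    then show ?thesis
      by (simp add: field_simps mult_le_0_iff)
  qed
  moreover have "(\<lambda>n. (v n - T (v n)) \<bullet> w) \<longlonglongrightarrow> w \<bullet> w"
  proof (rule tendsto_inner[OF _ tendsto_const], rule metric_tendsto_imp_tendsto)
    show "(\<lambda>n. (2 / (1 - \<kappa>) * norm w) * (1 / real (Suc n))) \<longlonglongrightarrow> 0"
      using tendsto_mult_left[OF LIMSEQ_Suc[OF lim_1_over_n], of "2 / (1 - \<kappa>) * norm w"]
      by simp
    have "norm ((v n - T (v n)) - w) \<le> (2 / (1 - \<kappa>) * norm w) * (1 / real (Suc n))" for n
    proof -
      have "(1 - \<kappa>) * norm ((v n - T (v n)) - w) \<le> 2 * norm (v n - q)"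
        using strict_pseudo_contraction_displacement_lipschitz[OF spc \<open>\<kappa> < 1\<close> v_in \<open>q \<in> C\<close>]
        by (simp add: w_def)
      also have "norm (v n - q) = 1 / real (Suc n) * norm w"
        by (simp add: v_def)
      finally have "norm ((v n - T (v n)) - w) \<le> 2 * (1 / real (Suc n) * norm w) / (1 - \<kappa>)"
        using \<open>\<kappa> < 1\<close> by (simp only: pos_le_divide_eq diff_gt_0_iff_gt mult.commute)
      then show ?thesis
        by (simp add: mult_ac)
    qed
    then show "\<forall>\<^sub>F n in sequentially.
        dist (v n - T (v n)) w \<le> dist ((2 / (1 - \<kappa>) * norm w) * (1 / real (Suc n))) 0"
      using \<open>\<kappa> < 1\<close> by (intro always_eventually allI) (simp add: dist_norm abs_mult)
  qed
  ultimately have "w \<bullet> w \<le> 0"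
    by (intro LIMSEQ_le_const2) auto
  then have "w = 0"
    by (metis inner_gt_zero_iff not_less)
  then show ?thesis
    by (simp add: w_def)
qed

lemma fixed_points_subset_minty_set:
  assumes "strict_pseudo_contraction_on \<kappa> C T" and "\<kappa> < 1" and "0 \<le> \<epsilon>"
  shows "fixed_points C T \<subseteq> minty_set C T \<epsilon>"
  using approximate_fixed_point_in_minty_set[OF assms(1,2) _ order_refl] assms(3)
  by (auto simp: fixed_points_def)

lemma fixed_points_eq_minty_set:
  assumes "strict_pseudo_contraction_on \<kappa> C T" and "\<kappa> < 1" and "convex C" and "T \<in> C \<rightarrow> C"
  shows "fixed_points C T = minty_set C T 0"
proof
  show "fixed_points C T \<subseteq> minty_set C T 0"
    using fixed_points_subset_minty_set assms(1,2) by blast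
  show "minty_set C T 0 \<subseteq> fixed_points C T"
    using minty_set_zero_fixed[OF assms] by (auto simp: fixed_points_def minty_set_def)
qed

text \<open>
  This plays the part that demiclosedness of \<open>I - T\<close> has in weak compactness arguments:
  \<open>minty_set C T (1 / Suc m)\<close> shrinks to the set of fixed points and
  eventually contains the approximate fixed points \<open>x n\<close>.
\<close>

lemma approximate_fixed_points_converge_to_projection:
  fixes C :: "'a::{real_inner, complete_space} set"
  assumes spc: "strict_pseudo_contraction_on \<kappa> C T" and "\<kappa> < 1"
    and "closed C" and "convex C" and T: "T \<in> C \<rightarrow> C"
    and p: "p \<in> fixed_points C T"
    and p_nearest: "\<And>q. q \<in> fixed_points C T \<Longrightarrow> dist a p \<le> dist a q"
    and x_in: "\<And>n. x n \<in> C"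
    and x_near: "\<And>n. dist a (x n) \<le> dist a p"
    and asymptotic: "(\<lambda>n. x n - T (x n)) \<longlonglongrightarrow> 0"
  shows "x \<longlonglongrightarrow> p"
proof -
  define K where "K m = minty_set C T (1 / real (Suc m))" for m
  define B where "B = norm a + dist a p"
  have "0 \<le> B"
    by (simp add: B_def)
  have norm_x: "norm (x n) \<le> B" for n
    using x_near[of n] norm_triangle_sub[of "x n" a] by (simp add: B_def dist_norm norm_minus_commute)
  show ?thesis
  proof (rule converges_to_nested_projection[where a = a and K = K])
    show "closed (K n)" "convex (K n)" for n
      by (simp_all add: K_def closed_minty_set convex_minty_set assms)
    show "K n \<subseteq> K m" if "m \<le> n" for m n
      unfolding K_def using that by (intro minty_set_mono) (simp add: frac_le)
    show "p \<in> K n" for n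
      using fixed_points_subset_minty_set[OF spc \<open>\<kappa> < 1\<close>, of "1 / real (Suc n)"] p
      by (auto simp: K_def)
    show "dist a (x n) \<le> dist a p" for n
      by (rule x_near)
  next
    fix q
    assume q: "\<And>n. q \<in> K n"
    have "(v - T v) \<bullet> (q - v) \<le> 0" if "v \<in> C" for v
    proof (rule LIMSEQ_le_const)
      show "(\<lambda>n. 1 / real (Suc n) * (1 + norm v)) \<longlonglongrightarrow> 0"
        using tendsto_mult_right[OF LIMSEQ_Suc[OF lim_1_over_n]] by force
      show "\<exists>N. \<forall>n\<ge>N. (v - T v) \<bullet> (q - v) \<le> 1 / real (Suc n) * (1 + norm v)"
        using q that unfolding K_def minty_set_def by blast
    qed
    moreover have "q \<in> C"
      using q[of 0] by (simp add: K_def minty_set_def)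
    ultimately have "q \<in> fixed_points C T"
      using fixed_points_eq_minty_set[OF spc \<open>\<kappa> < 1\<close> \<open>convex C\<close> T] by (simp add: minty_set_def)
    then show "dist a p \<le> dist a q"
      by (rule p_nearest)
  next
    fix m
    have "(\<lambda>n. norm (x n - T (x n)) * (1 + B)) \<longlonglongrightarrow> 0 * (1 + B)"
      by (intro tendsto_mult tendsto_const tendsto_norm_zero asymptotic)
    then have "\<forall>\<^sub>F n in sequentially. norm (x n - T (x n)) * (1 + B) < 1 / real (Suc m)"
      by (rule order_tendstoD(2)) simp
    then show "\<forall>\<^sub>F n in sequentially. x n \<in> K m"
      unfolding K_def
      by (rule eventually_mono)
        (auto intro: approximate_fixed_point_in_minty_set[OF spc \<open>\<kappa> < 1\<close> x_in norm_x])
  qed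
qed

section \<open>The projection scheme\<close>

text \<open>
  The correction terms, \<open>\<theta>\<close> included, undo the averaging with \<open>a\<close>: by the convexity identity
  \<open>\<parallel>(1-\<alpha>) a + \<alpha> t - z\<parallel>\<^sup>2 = (1-\<alpha>) \<parallel>a - z\<parallel>\<^sup>2 + \<alpha> \<parallel>t - z\<parallel>\<^sup>2 - \<alpha> (1-\<alpha>) \<parallel>a - t\<parallel>\<^sup>2\<close> all terms
  with the factor \<open>1 - \<alpha>\<close> cancel. Here \<open>t\<close> stands for the image of \<open>u\<close>.
\<close>

lemma cq_halfspace_simplified:
  fixes a t u z :: "'a::real_inner"
  shows "(norm ((1 - \<alpha>) *\<^sub>R a + \<alpha> *\<^sub>R t - z))\<^sup>2
      \<le> (norm (u - z))\<^sup>2 + 2 * (1 - \<alpha>) * ((u - a) \<bullet> z)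
        + ((1 - \<alpha>) * ((norm a)\<^sup>2 - (norm u)\<^sup>2) + \<alpha> * \<kappa> * (norm (u - t))\<^sup>2
           - \<alpha> * (1 - \<alpha>) * (norm (a - t))\<^sup>2)
    \<longleftrightarrow> \<alpha> * (norm (t - z))\<^sup>2 \<le> \<alpha> * ((norm (u - z))\<^sup>2 + \<kappa> * (norm (u - t))\<^sup>2)"
proof -
  have averaged: "(norm ((1 - \<alpha>) *\<^sub>R a + \<alpha> *\<^sub>R t - z))\<^sup>2
      = (1 - \<alpha>) * (norm (a - z))\<^sup>2 + \<alpha> * (norm (t - z))\<^sup>2 - \<alpha> * (1 - \<alpha>) * (norm (a - t))\<^sup>2"
    unfolding power2_norm_eq_inner
    by (simp add: inner_diff_left inner_diff_right inner_add_left inner_add_right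
        inner_commute algebra_simps)
  have anchor: "(norm (a - z))\<^sup>2
      = (norm (u - z))\<^sup>2 + 2 * ((u - a) \<bullet> z) + (norm a)\<^sup>2 - (norm u)\<^sup>2"
    unfolding power2_norm_eq_inner
    by (simp add: inner_diff_left inner_diff_right inner_commute algebra_simps)
  show ?thesis
    unfolding averaged anchor by (simp add: algebra_simps)
qed

text \<open>
  With \<open>t - z = (u - z) - (u - t)\<close> the terms \<open>\<parallel>u - z\<parallel>\<^sup>2\<close> cancel and the Cauchy-Schwarz
  inequality remains; \<open>\<kappa> < 1\<close> then makes the displacement \<open>u - t\<close> small with the step \<open>u - z\<close>.
\<close>

lemma displacement_le_step:
  fixes t u z :: "'a::real_inner"
  assumes "(norm (t - z))\<^sup>2 \<le> (norm (u - z))\<^sup>2 + \<kappa> * (norm (u - t))\<^sup>2"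
  shows "(1 - \<kappa>) * norm (u - t) \<le> 2 * norm (u - z)"
proof -
  have "(norm (t - z))\<^sup>2 = (norm (u - z))\<^sup>2 - 2 * ((u - t) \<bullet> (u - z)) + (norm (u - t))\<^sup>2"
    unfolding power2_norm_eq_inner
    by (simp add: inner_diff_left inner_diff_right inner_commute algebra_simps)
  with assms have "(1 - \<kappa>) * (norm (u - t))\<^sup>2 \<le> 2 * ((u - t) \<bullet> (u - z))"
    by (simp add: algebra_simps)
  also have "\<dots> \<le> 2 * (norm (u - t) * norm (u - z))"
    by (simp add: norm_cauchy_schwarz)
  finally have "norm (u - t) * ((1 - \<kappa>) * norm (u - t)) \<le> norm (u - t) * (2 * norm (u - z))"
    by (simp add: power2_eq_square mult_ac)
  then show ?thesis
    by (cases "norm (u - t) = 0") (auto simp: mult_le_cancel_left)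
qed

lemma obtuse_angle_pythagoras:
  fixes a u z :: "'a::real_inner"
  assumes "0 \<le> (z - u) \<bullet> (u - a)"
  shows "(dist u z)\<^sup>2 \<le> (dist a z)\<^sup>2 - (dist a u)\<^sup>2" and "dist a u \<le> dist a z"
proof -
  have "(dist a z)\<^sup>2 = (dist a u)\<^sup>2 + (dist u z)\<^sup>2 + 2 * ((z - u) \<bullet> (u - a))"
    unfolding dist_norm power2_norm_eq_inner
    by (simp add: inner_diff_left inner_diff_right inner_commute algebra_simps)
  with assms show "(dist u z)\<^sup>2 \<le> (dist a z)\<^sup>2 - (dist a u)\<^sup>2"
    by simp
  then have "(dist a u)\<^sup>2 \<le> (dist a z)\<^sup>2"
    using zero_le_power2[of "dist u z"] by linarith
  then show "dist a u \<le> dist a z"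
    by (rule power2_le_imp_le) simp
qed

text \<open>
  By the obtuse angle condition the squared steps are dominated by the increments of an
  increasing bounded sequence.
\<close>

lemma obtuse_steps_vanish:
  fixes x :: "nat \<Rightarrow> 'a::real_inner"
  assumes obtuse: "\<And>n. 0 \<le> (x (Suc n) - x n) \<bullet> (x n - a)" and bound: "\<And>n. dist a (x n) \<le> B"
  shows "(\<lambda>n. dist (x n) (x (Suc n))) \<longlonglongrightarrow> 0"
proof -
  have "incseq (\<lambda>n. dist a (x n))"
    using obtuse_angle_pythagoras(2)[OF obtuse] by (rule incseq_SucI)
  with bound obtain d where d: "(\<lambda>n. dist a (x n)) \<longlonglongrightarrow> d"
    by (meson incseq_convergent)
  have "(\<lambda>n. (dist a (x (Suc n)))\<^sup>2 - (dist a (x n))\<^sup>2) \<longlonglongrightarrow> d\<^sup>2 - d\<^sup>2"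
    by (intro tendsto_diff tendsto_power d LIMSEQ_Suc[OF d])
  then have "(\<lambda>n. (dist a (x (Suc n)))\<^sup>2 - (dist a (x n))\<^sup>2) \<longlonglongrightarrow> 0"
    by simp
  then have "(\<lambda>n. (dist (x n) (x (Suc n)))\<^sup>2) \<longlonglongrightarrow> 0"
    by (rule tendsto_sandwich[rotated 2, OF tendsto_const])
      (auto intro!: always_eventually obtuse_angle_pythagoras(1)[OF obtuse])
  then have "(\<lambda>n. sqrt ((dist (x n) (x (Suc n)))\<^sup>2)) \<longlonglongrightarrow> sqrt 0"
    by (rule tendsto_real_sqrt)
  then show ?thesis
    by simp
qed

theorem theorem7p2:
  fixes C :: "'a::{real_inner, complete_space} set"
    and T :: "'a \<Rightarrow> 'a"
    and \<kappa> :: real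
    and \<alpha> :: "nat \<Rightarrow> real"
    and x y :: "nat \<Rightarrow> 'a"
    and Cn Cstar Q :: "nat \<Rightarrow> 'a set"
    and \<theta> :: "nat \<Rightarrow> real"
  assumes "C \<noteq> {}" and "closed C" and "convex C"
    and "T \<in> C \<rightarrow> C"
    and "0 \<le> \<kappa>" and "\<kappa> < 1"
    and "strict_pseudo_contraction_on \<kappa> C T"
    and "fixed_points C T \<noteq> {}"
    and "\<And>n. \<alpha> n \<in> {0..1}"
    and "\<alpha> \<longlonglongrightarrow> 1"
    and "x 0 \<in> C"
    and "\<And>n. y n = (1 - \<alpha> n) *\<^sub>R x 0 + \<alpha> n *\<^sub>R T (x n)"
    and "\<And>n. \<theta> n = (1 - \<alpha> n) * ((norm (x 0))\<^sup>2 - (norm (x n))\<^sup>2)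
                  + \<alpha> n * \<kappa> * (norm (x n - T (x n)))\<^sup>2
                  - \<alpha> n * (1 - \<alpha> n) * (norm (x 0 - T (x n)))\<^sup>2"
    and "\<And>n. Cn n = {z \<in> C. (norm (y n - z))\<^sup>2
                  \<le> (norm (x n - z))\<^sup>2 + 2 * (1 - \<alpha> n) * ((x n - x 0) \<bullet> z) + \<theta> n}"
    and "\<And>n. Q n = {z \<in> C. (z - x n) \<bullet> (x n - x 0) \<ge> 0}"
    and "\<And>n. closed (Cstar n)" and "\<And>n. convex (Cstar n)"
    and "\<And>n. fixed_points C T \<subseteq> Cstar n" and "\<And>n. Cstar n \<subseteq> Cn n"
    and "\<And>n. x (Suc n) = metric_proj (Cstar n \<inter> Q n) (x 0)"
  shows "x \<longlonglongrightarrow> metric_proj (fixed_points C T) (x 0)"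
proof -
  note T = assms(4) and spc = assms(7) and step = assms(20)
  define F where "F = fixed_points C T"
  have F_sub: "F \<subseteq> Cstar n" for n
    using assms(18) by (simp add: F_def)
  have Cstar_sub: "Cstar n \<subseteq> C" for n
    using assms(14)[of n] assms(19)[of n] by auto
  have F_eq: "F = minty_set C T 0"
    unfolding F_def by (rule fixed_points_eq_minty_set[OF spc \<open>\<kappa> < 1\<close> \<open>convex C\<close> T])
  have "closed F" and "convex F" and "F \<noteq> {}"
    using closed_minty_set[OF \<open>closed C\<close>] convex_minty_set[OF \<open>convex C\<close>] F_eq assms(8) F_def
    by simp_all
  define p where "p = metric_proj F (x 0)"
  have "p \<in> F" and p_nearest: "\<And>q. q \<in> F \<Longrightarrow> dist (x 0) p \<le> dist (x 0) q"
    unfolding p_def by (fact metric_proj_nearest[OF \<open>closed F\<close> \<open>convex F\<close> \<open>F \<noteq> {}\<close>])+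

  have Q_eq: "Q n = C \<inter> {z. (x n - x 0) \<bullet> z \<ge> (x n - x 0) \<bullet> x n}" for n
    by (auto simp: assms(15) inner_diff_right inner_diff_left inner_commute)
  have closed_D: "closed (Cstar n \<inter> Q n)" for n
    unfolding Q_eq by (intro closed_Int assms(16) \<open>closed C\<close> closed_halfspace_ge)
  have convex_D: "convex (Cstar n \<inter> Q n)" for n
    unfolding Q_eq by (intro convex_Int assms(17) \<open>convex C\<close> convex_halfspace_ge)

  \<comment> \<open>The sets projected onto contain \<open>F\<close>, so they are nonempty and every projection exists.\<close>
  have F_sub_Q: "F \<subseteq> Q n" for n
  proof (induction n)
    case 0
    show ?case
      by (auto simp: assms(15) F_def fixed_points_def)
  next
    case (Suc n)
    show ?case
    proof
      fix z
      assume "z \<in> F"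
      then have "z \<in> Cstar n \<inter> Q n" and "z \<in> C"
        using Suc F_sub Cstar_sub by blast+
      then show "z \<in> Q (Suc n)"
        using metric_proj_obtuse[OF closed_D convex_D, of z n "x 0"]
        by (simp add: assms(15)[of "Suc n"] step)
    qed
  qed
  have x_Suc: "x (Suc n) \<in> Cstar n \<inter> Q n" for n
    unfolding step
    using \<open>F \<noteq> {}\<close> F_sub F_sub_Q by (intro metric_proj_nearest closed_D convex_D) blast
  have x_in: "x n \<in> C" for n
    using x_Suc Cstar_sub \<open>x 0 \<in> C\<close> by (cases n) auto
  have x_near: "dist (x 0) (x n) \<le> dist (x 0) p" for n
    using F_sub_Q \<open>p \<in> F\<close> by (intro obtuse_angle_pythagoras(2)) (auto simp: assms(15))
  have steps: "(\<lambda>n. dist (x n) (x (Suc n))) \<longlonglongrightarrow> 0"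
    using x_Suc x_near by (intro obtuse_steps_vanish[where a = "x 0"]) (auto simp: assms(15))

  have displacement: "norm (x n - T (x n)) \<le> 2 / (1 - \<kappa>) * dist (x n) (x (Suc n))"
    if "0 < \<alpha> n" for n
  proof -
    have "x (Suc n) \<in> Cn n"
      using x_Suc assms(19) by blast
    then have "\<alpha> n * (norm (T (x n) - x (Suc n)))\<^sup>2
        \<le> \<alpha> n * ((norm (x n - x (Suc n)))\<^sup>2 + \<kappa> * (norm (x n - T (x n)))\<^sup>2)"
      by (simp only: assms(12,13,14) mem_Collect_eq cq_halfspace_simplified)
    with that have "(1 - \<kappa>) * norm (x n - T (x n)) \<le> 2 * norm (x n - x (Suc n))"
      by (intro displacement_le_step) (simp add: mult_le_cancel_left)
    with \<open>\<kappa> < 1\<close> show ?thesis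
      by (simp add: dist_norm field_simps)
  qed
  have "(\<lambda>n. 2 / (1 - \<kappa>) * dist (x n) (x (Suc n))) \<longlonglongrightarrow> 0"
    using tendsto_mult_left[OF steps, of "2 / (1 - \<kappa>)"] by simp
  moreover have "\<forall>\<^sub>F n in sequentially. 0 < \<alpha> n"
    using \<open>\<alpha> \<longlonglongrightarrow> 1\<close> by (rule order_tendstoD) simp
  ultimately have asymptotic: "(\<lambda>n. x n - T (x n)) \<longlonglongrightarrow> 0"
    by (intro Lim_null_comparison[OF eventually_mono[OF _ displacement]])

  have "x \<longlonglongrightarrow> p"
    using approximate_fixed_points_converge_to_projection
      [OF spc \<open>\<kappa> < 1\<close> \<open>closed C\<close> \<open>convex C\<close> T, of p "x 0" x]
      \<open>p \<in> F\<close> p_nearest x_in x_near asymptotic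
    by (simp add: F_def)
  then show ?thesis
    by (simp add: p_def F_def)
qed

end
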